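(* For $n\in\mathbb{N}^+$, let $\mathrm{PHP}_n$ denote the pigeonhole principle formula $$\mathrm{PHP}_n=\bigcup_{i\in[n+1]}\{p_{i,1}\lor\dots\lor p_{i,n}\}\ \cup\bigcup_{\substack{i,j\in[n+1],\ i\neq j\\ k\in[n]}}\{\overline{p_{i,k}}\lor\overline{p_{j,k}}\}$$ over distinct propositional variables $p_{i,k}$ ($i\in[n+1]$, $k\in[n]$). Then $\mathrm{size}_{\mathsf{SBC}^-}(\mathrm{PHP}_n)=n^{O(1)}$.
   Context: $[n]=\{1,\dots,n\}$. A literal is a propositional variable or its negation; $\overline{p}$ is the complement of $p$, and $\overline{L}=\{\overline{p} : p\in L\}$ for a set $L$ of literals. A set of literals is tautological if it contains some $x$ and $\overline{x}$. A clause is a finite nontautological set of literals (read as a disjunction); $\bot$ is the empty clause. A CNF is a finite set of clauses; $\mathrm{var}(\Gamma)$ is the set of variables occurring in $\Gamma$. If $A\cup\{x\}$ and $B\cup\{\overline{x}\}$ are clauses with $x$ a variable not occurring in $A$ or $B$, and $A\cup B$ is a clause, then $A\cup B$ is their resolvent on $x$. A weakening of a clause $A$ is any clause $A\cup B$. A clause $C$ is a set-blocked clause (SBC) for a nonempty $L\subseteq C$ with respect to $\Gamma$ if for every $D\in\Gamma$ with $D\cap\overline{L}\neq\varnothing$ and $D\cap L=\varnothing$ the set $(C\setminus L)\cup(D\setminus\overline{L})$ is tautological. $C$ is an SBC with respect to $\Gamma$ if it is one for some nonempty $L\subseteq C$. An $\mathsf{SBC}^-$ proof (refutation) of $\Gamma$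 is a sequence $(\Gamma_1,\dots,\Gamma_N)$ of CNFs with $\Gamma_1=\Gamma$, $\bot\in\Gamma_N$, in which only variables of $\mathrm{var}(\Gamma)$ occur, and each $\Gamma_{i+1}=\Gamma_i\cup\{C\}$, where $C$ is a resolvent of two clauses of $\Gamma_i$, a weakening of a clause of $\Gamma_i$, or an SBC with respect to $\Gamma_i$. Its size is $N$; $\mathrm{size}_{\mathsf{SBC}^-}(\Gamma)$ is the minimum size of an $\mathsf{SBC}^-$ proof of $\Gamma$. *)

theory Defs
  imports Main "HOL-Library.Extended_Nat"
begin

datatype 'v literal = Pos (atm: 'v) | Neg (atm: 'v)

fun compl :: "'v literal \<Rightarrow> 'v literal" where
  "compl (Pos x) = Neg x"
| "compl (Neg x) = Pos x"

definition tautological :: "'v literal set \<Rightarrow> bool" where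
  "tautological A \<longleftrightarrow> (\<exists>x. Pos x \<in> A \<and> Neg x \<in> A)"

definition is_clause :: "'v literal set \<Rightarrow> bool" where
  "is_clause A \<longleftrightarrow> finite A \<and> \<not> tautological A"

definition is_cnf :: "'v literal set set \<Rightarrow> bool" where
  "is_cnf \<Gamma> \<longleftrightarrow> finite \<Gamma> \<and> (\<forall>A\<in>\<Gamma>. is_clause A)"

definition cnf_vars :: "'v literal set set \<Rightarrow> 'v set" where
  "cnf_vars \<Gamma> = (\<Union>A\<in>\<Gamma>. atm ` A)"

definition is_resolvent :: "'v literal set \<Rightarrow> 'v literal set \<Rightarrow> 'v literal set \<Rightarrow> bool" where
  "is_resolvent D E C \<longleftrightarrow>
     (\<exists>x A B. D = A \<union> {Pos x} \<and> E = B \<union> {Neg x} \<and> x \<notin> atm ` A \<and> x \<notin> atm ` B \<and>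
        is_clause D \<and> is_clause E \<and> C = A \<union> B \<and> is_clause C)"

definition is_weakening :: "'v literal set \<Rightarrow> 'v literal set \<Rightarrow> bool" where
  "is_weakening A C \<longleftrightarrow> is_clause A \<and> is_clause C \<and> (\<exists>B. C = A \<union> B)"

definition is_sbc_for :: "'v literal set set \<Rightarrow> 'v literal set \<Rightarrow> 'v literal set \<Rightarrow> bool" where
  "is_sbc_for \<Gamma> L C \<longleftrightarrow> is_clause C \<and> L \<noteq> {} \<and> L \<subseteq> C \<and>
     (\<forall>D\<in>\<Gamma>. D \<inter> compl ` L \<noteq> {} \<and> D \<inter> L = {} \<longrightarrow>
        tautological ((C - L) \<union> (D - compl ` L)))"

definition is_sbc :: "'v literal set set \<Rightarrow> 'v literal set \<Rightarrow> bool" where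
  "is_sbc \<Gamma> C \<longleftrightarrow> (\<exists>L. is_sbc_for \<Gamma> L C)"

definition sbc_minus_step :: "'v literal set set \<Rightarrow> 'v literal set set \<Rightarrow> bool" where
  "sbc_minus_step \<Gamma> \<Gamma>' \<longleftrightarrow>
     (\<exists>C. \<Gamma>' = \<Gamma> \<union> {C} \<and>
        ((\<exists>D\<in>\<Gamma>. \<exists>E\<in>\<Gamma>. is_resolvent D E C) \<or> (\<exists>A\<in>\<Gamma>. is_weakening A C) \<or> is_sbc \<Gamma> C))"

definition is_sbc_minus_proof :: "'v literal set set \<Rightarrow> 'v literal set set list \<Rightarrow> bool" where
  "is_sbc_minus_proof \<Gamma> \<Pi> \<longleftrightarrow>
     \<Pi> \<noteq> [] \<and> hd \<Pi> = \<Gamma> \<and> {} \<in> last \<Pi> \<and>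
     (\<forall>\<Delta>\<in>set \<Pi>. is_cnf \<Delta> \<and> cnf_vars \<Delta> \<subseteq> cnf_vars \<Gamma>) \<and>
     (\<forall>i. Suc i < length \<Pi> \<longrightarrow> sbc_minus_step (\<Pi> ! i) (\<Pi> ! Suc i))"

(* The infimum in enat is attained if a proof exists, and is \<infinity> if there is none. *)
definition size_sbc_minus :: "'v literal set set \<Rightarrow> enat" where
  "size_sbc_minus \<Gamma> = (INF \<Pi>\<in>{\<Pi>. is_sbc_minus_proof \<Gamma> \<Pi>}. enat (length \<Pi>))"

(* The pair (i, k) is the variable p_{i,k}. *)
definition PHP :: "nat \<Rightarrow> (nat \<times> nat) literal set set" where
  "PHP n =
     (\<Union>i\<in>{1..n+1}. {{Pos (i, k) | k. k \<in> {1..n}}}) \<union>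
     (\<Union>i\<in>{1..n+1}. \<Union>j\<in>{1..n+1} - {i}. \<Union>k\<in>{1..n}. {{Neg (i, k), Neg (j, k)}})"

end

theory Submission
  imports Defs
begin

text \<open>
  Write \<open>(i, m)\<close> for the variable saying that pigeon \<open>i\<close> sits in hole \<open>m\<close>.  If pigeon \<open>i \<le> m\<close> sits in
  hole \<open>m\<close> and pigeon \<open>m + 1\<close> sits in hole \<open>j < m\<close>, the two may swap holes.  The clause that forbids this
  situation becomes set-blocked once it also lists every other variable of the columns \<open>j\<close> and \<open>m\<close>:
  the flipped literals are the four corners of the swap, and each hole axiom they falsify is
  tautological together with the remaining literals.  These clauses can all be added before any
  resolution step, as long as \<open>m\<close> decreases.  Resolving them with the hole axioms gives
  \<open>\<not>(i, m) \<or> \<not>(m + 1, j)\<close> for all \<open>i \<le> m\<close> and \<open>j < m\<close>; so pigeon \<open>m + 1\<close>, when restricted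
  to the holes up to \<open>m\<close>, forces \<open>\<not>(i, m)\<close>, and the pigeons \<open>1, \<dots>, m\<close> are restricted to the holes
  up to \<open>m - 1\<close>.
\<close>

section \<open>Derivations with counted steps\<close>

definition cnf_over :: "'v set \<Rightarrow> 'v literal set set \<Rightarrow> bool" where
  "cnf_over V \<Gamma> \<longleftrightarrow> is_cnf \<Gamma> \<and> cnf_vars \<Gamma> \<subseteq> V"

lemma cnf_over_insert:
  "cnf_over V \<Gamma> \<Longrightarrow> is_clause C \<Longrightarrow> atm ` C \<subseteq> V \<Longrightarrow> cnf_over V (insert C \<Gamma>)"
  by (auto simp: cnf_over_def is_cnf_def cnf_vars_def)

lemma cnf_overD:
  assumes "cnf_over V \<Gamma>" "C \<in> \<Gamma>"
  shows "is_clause C" "atm ` C \<subseteq> V"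
  using assms by (auto simp: cnf_over_def is_cnf_def cnf_vars_def)

text \<open>The number \<open>k\<close> is only an upper bound on the number of steps.\<close>

inductive derives :: "'v set \<Rightarrow> nat \<Rightarrow> 'v literal set set \<Rightarrow> 'v literal set set \<Rightarrow> bool" for V where
  refl: "derives V k \<Gamma> \<Gamma>"
| step: "sbc_minus_step \<Gamma> \<Gamma>' \<Longrightarrow> cnf_over V \<Gamma>' \<Longrightarrow> derives V k \<Gamma>' \<Gamma>'' \<Longrightarrow> derives V (Suc k) \<Gamma> \<Gamma>''"

lemma derives_mono: "derives V k \<Gamma> \<Delta> \<Longrightarrow> k \<le> l \<Longrightarrow> derives V l \<Gamma> \<Delta>"
proof (induction arbitrary: l rule: derives.induct)
  case (step \<Gamma> \<Gamma>' k \<Gamma>'')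
  then show ?case by (cases l) (auto intro: derives.step)
qed (rule derives.refl)

lemma derives_trans:
  "derives V k \<Gamma> \<Gamma>' \<Longrightarrow> derives V l \<Gamma>' \<Gamma>'' \<Longrightarrow> derives V (k + l) \<Gamma> \<Gamma>''"
proof (induction rule: derives.induct)
  case (refl k \<Gamma>)
  then show ?case by (rule derives_mono) simp
qed (auto intro: derives.step)

lemma derives_cnf_over: "derives V k \<Gamma> \<Delta> \<Longrightarrow> cnf_over V \<Gamma> \<Longrightarrow> cnf_over V \<Delta>"
  by (induction rule: derives.induct) auto

lemma derives_insert:
  assumes "cnf_over V \<Gamma>" "is_clause C" "atm ` C \<subseteq> V"
    and "(\<exists>D\<in>\<Gamma>. \<exists>E\<in>\<Gamma>. is_resolvent D E C) \<or> (\<exists>A\<in>\<Gamma>. is_weakening A C) \<or> is_sbc \<Gamma> C"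
  shows "derives V 1 \<Gamma> (insert C \<Gamma>)"
proof -
  have "sbc_minus_step \<Gamma> (insert C \<Gamma>)"
    using assms(4) unfolding sbc_minus_step_def by (intro exI[of _ C]) auto
  then show ?thesis
    using derives.step[OF _ cnf_over_insert[OF assms(1-3)] derives.refl[of V 0]] by simp
qed

lemma derives_proof:
  assumes "derives V k \<Gamma> \<Delta>" "cnf_over V \<Gamma>"
  shows "\<exists>\<Pi>. \<Pi> \<noteq> [] \<and> hd \<Pi> = \<Gamma> \<and> last \<Pi> = \<Delta> \<and> length \<Pi> \<le> Suc k \<and>
    (\<forall>\<Theta>\<in>set \<Pi>. cnf_over V \<Theta>) \<and>
    (\<forall>i. Suc i < length \<Pi> \<longrightarrow> sbc_minus_step (\<Pi> ! i) (\<Pi> ! Suc i))"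
  using assms
proof (induction rule: derives.induct)
  case (refl k \<Gamma>)
  then show ?case by (intro exI[of _ "[\<Gamma>]"]) auto
next
  case (step \<Gamma> \<Gamma>' k \<Gamma>'')
  then obtain \<Pi> where "\<Pi> \<noteq> []" "hd \<Pi> = \<Gamma>'" "last \<Pi> = \<Gamma>''" "length \<Pi> \<le> Suc k"
    "\<forall>\<Theta>\<in>set \<Pi>. cnf_over V \<Theta>"
    "\<forall>i. Suc i < length \<Pi> \<longrightarrow> sbc_minus_step (\<Pi> ! i) (\<Pi> ! Suc i)" by blast
  with step show ?case
    by (intro exI[of _ "\<Gamma> # \<Pi>"]) (auto simp: nth_Cons hd_conv_nth split: nat.splits)
qed

text \<open>The size of a proof counts CNFs rather than steps, hence \<open>Suc k\<close>. The
  parameter \<open>V\<close> becomes the variable set of the initial formula, which every later CNF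
  must respect.\<close>

lemma size_sbc_minus_le:
  assumes "is_cnf \<Gamma>" "derives (cnf_vars \<Gamma>) k \<Gamma> \<Delta>" "{} \<in> \<Delta>"
  shows "size_sbc_minus \<Gamma> \<le> enat (Suc k)"
proof -
  have "cnf_over (cnf_vars \<Gamma>) \<Gamma>" using assms(1) by (simp add: cnf_over_def)
  from derives_proof[OF assms(2) this] assms(3) obtain \<Pi> where
    "is_sbc_minus_proof \<Gamma> \<Pi>" "length \<Pi> \<le> Suc k"
    unfolding is_sbc_minus_proof_def cnf_over_def by blast
  then show ?thesis
    unfolding size_sbc_minus_def by (intro INF_lower2[of \<Pi>]) auto
qed

text \<open>Set-blockedness can be lost when clauses are added. Demanding it against every
  \<open>T \<subseteq> S\<close> makes the clauses of \<open>S\<close> insertable in any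
  order.\<close>

lemma derives_sbcs:
  assumes "finite S" "cnf_over V \<Gamma>"
    and "\<And>C. C \<in> S \<Longrightarrow> atm ` C \<subseteq> V"
    and "\<And>C T. C \<in> S \<Longrightarrow> T \<subseteq> S \<Longrightarrow> is_sbc (\<Gamma> \<union> T) C"
  shows "derives V (card S) \<Gamma> (\<Gamma> \<union> S)"
  using assms(1,3,4)
proof (induction rule: finite_induct)
  case empty
  then show ?case by (simp add: derives.refl)
next
  case (insert C S)
  have d: "derives V (card S) \<Gamma> (\<Gamma> \<union> S)"
  proof (rule insert.IH)
    show "atm ` D \<subseteq> V" if "D \<in> S" for D using insert.prems(1)[of D] that by simp
    show "is_sbc (\<Gamma> \<union> T) D" if "D \<in> S" "T \<subseteq> S" for D T
      using that by (intro insert.prems(2)) auto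
  qed
  have s: "is_sbc (\<Gamma> \<union> S) C" using insert.prems(2) by auto
  then have "is_clause C" by (auto simp: is_sbc_def is_sbc_for_def)
  then have "derives V 1 (\<Gamma> \<union> S) (insert C (\<Gamma> \<union> S))"
    using s insert.prems(1)[of C] by (intro derives_insert[OF derives_cnf_over[OF d assms(2)]]) simp_all
  from derives_trans[OF d this] insert.hyps show ?case by simp
qed

section \<open>Resolution up to extra clauses\<close>

text \<open>A superset is enough because resolution and weakening stay applicable when clauses are
  added, so auxiliary clauses need not be tracked. This fails for set-blocked clauses, whose
  derivation is stated with the exact final set through \<open>derives\<close>.\<close>

definition reaches :: "'v set \<Rightarrow> nat \<Rightarrow> 'v literal set set \<Rightarrow> 'v literal set set \<Rightarrow> bool" where
  "reaches V k \<Gamma> S \<longleftrightarrow> (\<exists>\<Delta>. derives V k \<Gamma> \<Delta> \<and> \<Gamma> \<union> S \<subseteq> \<Delta>)"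

lemma reaches_mono: "reaches V k \<Gamma> S \<Longrightarrow> k \<le> l \<Longrightarrow> T \<subseteq> S \<Longrightarrow> reaches V l \<Gamma> T"
  unfolding reaches_def by (meson derives_mono Un_mono order.trans order_refl)

lemma reaches_refl: "S \<subseteq> \<Gamma> \<Longrightarrow> reaches V k \<Gamma> S"
  unfolding reaches_def by (auto intro: derives.refl)

lemma reaches_trans:
  assumes "reaches V k \<Gamma> S" "cnf_over V \<Gamma>"
    and "\<And>\<Delta>. \<Gamma> \<union> S \<subseteq> \<Delta> \<Longrightarrow> cnf_over V \<Delta> \<Longrightarrow> reaches V l \<Delta> T"
  shows "reaches V (k + l) \<Gamma> (S \<union> T)"
proof -
  from assms(1) obtain \<Delta> where \<Delta>: "derives V k \<Gamma> \<Delta>" "\<Gamma> \<union> S \<subseteq> \<Delta>" by (auto simp: reaches_def)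
  with assms obtain \<Theta> where "derives V l \<Delta> \<Theta>" "\<Delta> \<union> T \<subseteq> \<Theta>"
    by (meson derives_cnf_over reaches_def)
  with \<Delta> derives_trans show ?thesis unfolding reaches_def by blast
qed

lemma reaches_UN:
  assumes "finite I" "cnf_over V \<Gamma>"
    and "\<And>i \<Delta>. i \<in> I \<Longrightarrow> \<Gamma> \<subseteq> \<Delta> \<Longrightarrow> cnf_over V \<Delta> \<Longrightarrow> reaches V k \<Delta> (S i)"
  shows "reaches V (card I * k) \<Gamma> (\<Union>i\<in>I. S i)"
  using assms(1,3)
proof (induction rule: finite_induct)
  case empty
  then show ?case by (simp add: reaches_refl)
next
  case (insert i I)
  have "reaches V (card I * k) \<Gamma> (\<Union>i\<in>I. S i)"
    by (rule insert.IH) (use insert.prems in auto)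
  then have "reaches V (card I * k + k) \<Gamma> ((\<Union>i\<in>I. S i) \<union> S i)"
    by (rule reaches_trans[OF _ assms(2)]) (use insert.prems in auto)
  then show ?case using insert.hyps by (simp add: Un_commute add.commute)
qed

lemma reaches_weakening:
  assumes "cnf_over V \<Gamma>" "D \<in> \<Gamma>" "D \<subseteq> C" "is_clause C" "atm ` C \<subseteq> V"
  shows "reaches V 1 \<Gamma> {C}"
proof -
  have "is_weakening D C"
    using assms cnf_overD(1) by (auto simp: is_weakening_def)
  with assms derives_insert[of V \<Gamma> C] show ?thesis by (auto simp: reaches_def)
qed

lemma reaches_resolvent:
  assumes "cnf_over V \<Gamma>" "insert (Pos x) A \<in> \<Gamma>" "insert (Neg x) B \<in> \<Gamma>"
    and "x \<notin> atm ` A" "x \<notin> atm ` B" "is_clause (A \<union> B)"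
  shows "reaches V 1 \<Gamma> {A \<union> B}"
proof -
  have "is_resolvent (insert (Pos x) A) (insert (Neg x) B) (A \<union> B)"
    unfolding is_resolvent_def
    by (intro exI[of _ x] exI[of _ A] exI[of _ B]) (use assms cnf_overD(1) in auto)
  moreover have "atm ` (A \<union> B) \<subseteq> V"
    using cnf_overD(2)[OF assms(1,2)] cnf_overD(2)[OF assms(1,3)] by auto
  ultimately show ?thesis
    using assms(2,3) derives_insert[OF assms(1,6)] by (auto simp: reaches_def)
qed

text \<open>Resolving on \<open>x\<close> against \<open>{Neg x, Neg y}\<close> only deletes
  \<open>Pos x\<close>, since \<open>Neg y\<close> already lies in \<open>D\<close>. One resolution
  per element of \<open>X\<close> therefore suffices.\<close>

lemma reaches_hyperresolvent_aux:
  assumes "finite X" "cnf_over V \<Gamma>" "Pos ` X \<union> D \<in> \<Gamma>" "Neg y \<in> D"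
    and "X \<inter> atm ` D = {}" "\<And>x. x \<in> X \<Longrightarrow> {Neg x, Neg y} \<in> \<Gamma>"
  shows "reaches V (card X) \<Gamma> {D}"
  using assms
proof (induction arbitrary: \<Gamma> rule: finite_induct)
  case empty
  then show ?case by (simp add: reaches_refl)
next
  case (insert x X)
  have "is_clause (Pos ` X \<union> D)"
    using cnf_overD(1)[OF insert.prems(1,2)]
    by (auto simp: is_clause_def tautological_def)
  moreover have "Pos ` X \<union> D \<union> {Neg y} = Pos ` X \<union> D" using insert.prems(3) by auto
  moreover have "x \<noteq> y" using insert.prems(3,4) by force
  ultimately have "reaches V 1 \<Gamma> {Pos ` X \<union> D}"
    using reaches_resolvent[OF insert.prems(1), of x "Pos ` X \<union> D" "{Neg y}"] insert
    by (auto simp: image_Un image_image)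
  then have "reaches V (1 + card X) \<Gamma> ({Pos ` X \<union> D} \<union> {D})"
    by (rule reaches_trans[OF _ insert.prems(1)], intro insert.IH) (use insert.prems in auto)
  then show ?case using insert.hyps by (auto elim: reaches_mono)
qed

text \<open>A single weakening adds \<open>Neg y\<close> in advance, which accounts for the
  \<open>Suc\<close> in the cost.\<close>

lemma reaches_hyperresolvent:
  assumes "finite X" "cnf_over V \<Gamma>" "Pos ` X \<union> D \<in> \<Gamma>" "Pos y \<notin> D" "y \<in> V" "y \<notin> X"
    and "X \<inter> atm ` D = {}" "\<And>x. x \<in> X \<Longrightarrow> {Neg x, Neg y} \<in> \<Gamma>"
  shows "reaches V (Suc (card X)) \<Gamma> {insert (Neg y) D}"
proof -
  let ?C = "Pos ` X \<union> insert (Neg y) D"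
  have "reaches V 1 \<Gamma> {?C}"
    by (rule reaches_weakening[OF assms(2,3)])
       (use cnf_overD[OF assms(2,3)] assms(4-6) in \<open>auto simp: is_clause_def tautological_def\<close>)
  then have "reaches V (1 + card X) \<Gamma> ({?C} \<union> {insert (Neg y) D})"
    by (rule reaches_trans[OF _ assms(2)], intro reaches_hyperresolvent_aux) (use assms in auto)
  then show ?thesis by (auto elim: reaches_mono)
qed

section \<open>Swap clauses and pigeonhole axioms\<close>

definition swap_vars :: "nat \<Rightarrow> nat \<Rightarrow> nat \<Rightarrow> nat \<Rightarrow> (nat \<times> nat) set" where
  "swap_vars n m i j = {1..n+1} \<times> {j, m} - {(i, m), (m+1, j)}"

text \<open>Its negation fixes columns \<open>j\<close> and \<open>m\<close> completely: pigeon
  \<open>i\<close> alone is in hole \<open>m\<close>, and pigeon \<open>m+1\<close> alone is in hole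
  \<open>j\<close>.\<close>

definition swap_clause :: "nat \<Rightarrow> nat \<Rightarrow> nat \<Rightarrow> nat \<Rightarrow> (nat \<times> nat) literal set" where
  "swap_clause n m i j = {Neg (i, m), Neg (m+1, j)} \<union> Pos ` swap_vars n m i j"

definition swap_clauses :: "nat \<Rightarrow> nat \<Rightarrow> (nat \<times> nat) literal set set" where
  "swap_clauses n m = (\<lambda>(i, j). swap_clause n m i j) ` ({1..m} \<times> {1..<m})"

lemma card_swap_clauses: "card (swap_clauses n m) \<le> m * m"
proof -
  have "card (swap_clauses n m) \<le> card ({1..m} \<times> {1..<m})"
    unfolding swap_clauses_def by (rule card_image_le) simp
  also have "\<dots> \<le> m * m" by (simp add: card_cartesian_product)
  finally show ?thesis .
qed

lemma PHP_iff:
  "D \<in> PHP n \<longleftrightarrow> (\<exists>i\<in>{1..n+1}. D = Pos ` ({i} \<times> {1..n})) \<or>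
    (\<exists>a\<in>{1..n+1}. \<exists>b\<in>{1..n+1} - {a}. \<exists>k\<in>{1..n}. D = {Neg (a, k), Neg (b, k)})"
proof -
  have "{Pos (i, k) | k. k \<in> {1..n}} = Pos ` ({i} \<times> {1..n})" for i :: nat by auto
  then show ?thesis unfolding PHP_def by (simp only: Un_iff UN_iff singleton_iff)
qed

lemma hole_in_PHP:
  "a \<in> {1..n+1} \<Longrightarrow> b \<in> {1..n+1} \<Longrightarrow> a \<noteq> b \<Longrightarrow> k \<in> {1..n} \<Longrightarrow> {Neg (a, k), Neg (b, k)} \<in> PHP n"
  unfolding PHP_iff by (intro disjI2 bexI[of _ a] bexI[of _ b] bexI[of _ k]) auto

lemma pigeon_in_PHP: "i \<in> {1..n+1} \<Longrightarrow> Pos ` ({i} \<times> {1..n}) \<in> PHP n"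
  unfolding PHP_iff by blast

lemma PHP_cases:
  assumes "D \<in> PHP n"
  obtains (pigeon) i where "i \<in> {1..n+1}" "D = Pos ` ({i} \<times> {1..n})"
  | (hole) a b k where "a \<in> {1..n+1}" "b \<in> {1..n+1}" "a \<noteq> b" "k \<in> {1..n}"
      "D = {Neg (a, k), Neg (b, k)}"
  using assms unfolding PHP_iff by (elim disjE bexE DiffE) simp_all

lemma cnf_over_PHP: "cnf_over ({1..n+1} \<times> {1..n}) (PHP n)"
proof -
  have "finite (PHP n)" by (simp add: PHP_def)
  moreover have "is_clause D \<and> atm ` D \<subseteq> {1..n+1} \<times> {1..n}" if "D \<in> PHP n" for D
    using that by (cases rule: PHP_cases) (auto simp: is_clause_def tautological_def)
  ultimately show ?thesis by (auto simp: cnf_over_def is_cnf_def cnf_vars_def)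
qed

lemma cnf_vars_PHP: "cnf_vars (PHP n) = {1..n+1} \<times> {1..n}"
proof
  show "cnf_vars (PHP n) \<subseteq> {1..n+1} \<times> {1..n}" using cnf_over_PHP by (simp add: cnf_over_def)
  show "{1..n+1} \<times> {1..n} \<subseteq> cnf_vars (PHP n)"
  proof
    fix x assume "x \<in> {1..n+1} \<times> {1..n}"
    then have "Pos x \<in> Pos ` ({fst x} \<times> {1..n})" "Pos ` ({fst x} \<times> {1..n}) \<in> PHP n"
      using pigeon_in_PHP[of "fst x" n] by (auto simp: mem_Times_iff)
    then show "x \<in> cnf_vars (PHP n)"
      unfolding cnf_vars_def by (metis UN_I imageI literal.sel(1))
  qed
qed

text \<open>The bound \<open>m \<le> m'\<close> on the clauses already present is what forces
  decreasing \<open>m\<close>: a swap clause with \<open>m' = j\<close> and \<open>i' = i\<close>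
  would contain \<open>Neg (i, j)\<close> and lack \<open>Pos (i, j)\<close>. Clauses with
  \<open>m' = m\<close> do not obstruct each other.\<close>

lemma swap_clause_is_sbc:
  assumes ij: "i \<in> {1..m}" "j \<in> {1..<m}" "m \<le> n"
    and \<Gamma>: "\<Gamma> \<subseteq> PHP n \<union> (\<Union>m'\<in>{m..n}. swap_clauses n m')"
  shows "is_sbc \<Gamma> (swap_clause n m i j)"
proof -
  let ?C = "swap_clause n m i j"
  \<comment> \<open>Making all of \<open>?L\<close> true on the forbidden situation moves pigeon
    \<open>i\<close> to hole \<open>j\<close> and pigeon \<open>m+1\<close> to hole
    \<open>m\<close>.\<close>
  let ?L = "{Neg (i, m), Neg (m+1, j), Pos (i, j), Pos (m+1, m)}"
  have cl: "is_clause ?C"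
    by (auto simp: is_clause_def tautological_def swap_clause_def swap_vars_def)
  have sub: "?L \<subseteq> ?C" using ij by (auto simp: swap_clause_def swap_vars_def)
  have cL: "compl ` ?L = {Pos (i, m), Pos (m+1, j), Neg (i, j), Neg (m+1, m)}" by simp
  have CL: "Pos (l, k) \<in> ?C - ?L" if "l \<in> {1..n+1}" "l \<noteq> i" "l \<noteq> m+1" "k \<in> {j, m}" for l k
    using that by (auto simp: swap_clause_def swap_vars_def)
  have "tautological ((?C - ?L) \<union> (D - compl ` ?L))"
    if D: "D \<in> \<Gamma>" "D \<inter> compl ` ?L \<noteq> {}" "D \<inter> ?L = {}" for D
  proof -
    from D(1) \<Gamma> consider "D \<in> PHP n" | m' i' j' where "m \<le> m'" "m' \<le> n" "i' \<in> {1..m'}"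
      "j' \<in> {1..<m'}" "D = swap_clause n m' i' j'"
    proof (cases "D \<in> PHP n")
      case False
      with D(1) \<Gamma> obtain m' where m': "m' \<in> {m..n}" "D \<in> swap_clauses n m'" by blast
      then obtain i' j' where "i' \<in> {1..m'}" "j' \<in> {1..<m'}" "D = swap_clause n m' i' j'"
        unfolding swap_clauses_def by blast
      with m' show ?thesis by (intro that(2)[of m' i' j']) auto
    qed (use that in blast)
    then show ?thesis
    proof cases
      case 1
      then show ?thesis
      proof (cases rule: PHP_cases)
        case (pigeon a)
        \<comment> \<open>Row \<open>i\<close> contains both \<open>Pos (i, m)\<close> and
          \<open>Pos (i, j)\<close>, and row \<open>m+1\<close> both \<open>Pos (m+1, j)\<close> and
          \<open>Pos (m+1, m)\<close>; a touched pigeon axiom thus meets \<open>?L\<close>.\<close>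
        with D(2) have "a = i \<or> a = m+1" unfolding cL by auto
        with pigeon ij have "D \<inter> ?L \<noteq> {}" by auto
        with D(3) show ?thesis by contradiction
      next
        case (hole a b k)
        have k: "(a = i \<or> b = i) \<and> k = j \<or> (a = m+1 \<or> b = m+1) \<and> k = m"
          using D(2) unfolding cL hole(5) by auto
        moreover have "k = j \<Longrightarrow> a \<noteq> m+1 \<and> b \<noteq> m+1" "k = m \<Longrightarrow> a \<noteq> i \<and> b \<noteq> i"
          using D(3) unfolding hole(5) by auto
        \<comment> \<open>One pigeon of the hole axiom is the one that moved into hole
          \<open>k\<close>. The other cannot be the one that left it, so it is a third pigeon
          \<open>l\<close>, and \<open>Pos (l, k)\<close> remains in the swap clause.\<close>
        ultimately have "a \<noteq> i \<and> a \<noteq> m+1 \<or> b \<noteq> i \<and> b \<noteq> m+1" using hole(3) by auto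
        then obtain l where l: "l \<in> {a, b}" "l \<noteq> i" "l \<noteq> m+1" by blast
        then have "Neg (l, k) \<in> D" "l \<in> {1..n+1}" "k \<in> {j, m}" using hole k by auto
        then have "Neg (l, k) \<in> D - compl ` ?L" using l unfolding cL by auto
        moreover have "Pos (l, k) \<in> ?C - ?L" by (rule CL) fact+
        ultimately show ?thesis unfolding tautological_def by blast
      qed
    next
      case 2
      have pos: "Pos (l, k) \<in> D"
        if "l \<in> {1..n+1}" "k \<in> {j', m'}" "(l, k) \<noteq> (i', m')" "(l, k) \<noteq> (m'+1, j')" for l k
        using that unfolding 2(5) swap_clause_def swap_vars_def by (intro UnI2 imageI) simp
      from D(2) obtain x where x: "x \<in> D" "x \<in> compl ` ?L" by blast
      \<comment> \<open>The two swap clauses must share a column, and \<open>m' = j\<close> is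
        excluded by \<open>j < m \<le> m'\<close>. In either remaining case the shared column
        supplies a positive corner of \<open>?L\<close>, because neither of the two variables
        omitted from the positive part of \<open>D\<close> is that corner.\<close>
      have "snd (atm x) \<in> {j', m'}"
        using x(1) unfolding 2(5) swap_clause_def swap_vars_def by auto
      moreover have "snd (atm x) \<in> {j, m}" using x(2) unfolding cL by auto
      ultimately have "j' = j \<or> m' = j \<or> j' = m \<or> m' = m" by auto
      then consider "j' = j" "m' \<noteq> m" | "m \<in> {j', m'}"
        using 2(1) ij(2) by fastforce
      then have "Pos (i, j) \<in> D \<or> Pos (m+1, m) \<in> D"
      proof cases
        case 1
        with pos[of i j] 2 ij show ?thesis by auto
      next
        case 2
        with pos[of "m+1" m] \<open>m \<le> m'\<close> \<open>i' \<in> {1..m'}\<close> \<open>j' \<in> {1..<m'}\<close> ij show ?thesis by auto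
      qed
      with D(3) show ?thesis by auto
    qed
  qed
  with cl sub have "is_sbc_for \<Gamma> ?L ?C" unfolding is_sbc_for_def by simp
  then show ?thesis unfolding is_sbc_def by (rule exI)
qed

text \<open>The layers are added from \<open>m = n\<close> downwards, each with at most
  \<open>n * n\<close> clauses.\<close>

lemma derives_swap_clauses:
  assumes "d \<le> n"
  shows "derives ({1..n+1} \<times> {1..n}) (d * (n * n))
    (PHP n) (PHP n \<union> (\<Union>m\<in>{n-d<..n}. swap_clauses n m))"
  using assms
proof (induction d)
  case 0
  then show ?case by (simp add: derives.refl)
next
  case (Suc d)
  let ?V = "{1..n+1} \<times> {1..n}" and ?m = "n - d"
  let ?\<Gamma> = "PHP n \<union> (\<Union>m\<in>{?m<..n}. swap_clauses n m)"
  have IH: "derives ?V (d * (n * n)) (PHP n) ?\<Gamma>" using Suc by simp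
  have "derives ?V (card (swap_clauses n ?m)) ?\<Gamma> (?\<Gamma> \<union> swap_clauses n ?m)"
  proof (rule derives_sbcs)
    show "finite (swap_clauses n ?m)" by (simp add: swap_clauses_def)
    show "cnf_over ?V ?\<Gamma>" by (rule derives_cnf_over[OF IH cnf_over_PHP])
    show "atm ` C \<subseteq> ?V" if "C \<in> swap_clauses n ?m" for C
      using that by (auto simp: swap_clauses_def swap_clause_def swap_vars_def)
    show "is_sbc (?\<Gamma> \<union> T) C" if "C \<in> swap_clauses n ?m" "T \<subseteq> swap_clauses n ?m" for C T
    proof -
      from that(1) obtain i j where "i \<in> {1..?m}" "j \<in> {1..<?m}" "C = swap_clause n ?m i j"
        by (auto simp: swap_clauses_def)
      \<comment> \<open>The range includes \<open>?m\<close> itself, so the order within a layer is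
        free.\<close>
      moreover have "?\<Gamma> \<union> T \<subseteq> PHP n \<union> (\<Union>m'\<in>{?m..n}. swap_clauses n m')"
        using that(2) by (fastforce simp: less_imp_le)
      ultimately show ?thesis using swap_clause_is_sbc by simp
    qed
  qed
  moreover have "card (swap_clauses n ?m) \<le> n * n"
    by (rule order.trans[OF card_swap_clauses mult_le_mono]) auto
  ultimately have "derives ?V (n * n) ?\<Gamma> (?\<Gamma> \<union> swap_clauses n ?m)"
    by (rule derives_mono)
  from derives_trans[OF IH this]
  have "derives ?V (Suc d * (n * n)) (PHP n) (?\<Gamma> \<union> swap_clauses n ?m)"
    by (simp add: add.commute)
  moreover have "{n - Suc d<..n} = insert ?m {?m<..n}" using Suc.prems by auto
  ultimately show ?case by (simp add: Un_ac)
qed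

section \<open>Resolution from the swap clauses to the empty clause\<close>

lemma reaches_pair:
  assumes \<Gamma>: "cnf_over ({1..n+1} \<times> {1..n}) \<Gamma>" "PHP n \<subseteq> \<Gamma>" "swap_clauses n m \<subseteq> \<Gamma>"
    and ij: "i \<in> {1..m}" "j \<in> {1..<m}" "m \<le> n"
  shows "reaches ({1..n+1} \<times> {1..n}) (2 * n + 2) \<Gamma> {{Neg (i, m), Neg (m+1, j)}}"
proof -
  let ?V = "{1..n+1} \<times> {1..n}"
  \<comment> \<open>The positive literals are split by column. Hole axioms of \<open>j\<close> with
    pigeon \<open>m+1\<close> remove \<open>?X\<close>, then those of \<open>m\<close> with pigeon
    \<open>i\<close> remove \<open>?Y\<close>; each column costs \<open>n + 1\<close>.\<close>
  let ?X = "({1..n+1} - {m+1}) \<times> {j}" and ?Y = "({1..n+1} - {i}) \<times> {m}"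
  let ?D = "insert (Neg (m+1, j)) (insert (Neg (i, m)) (Pos ` ?Y))"
  have "swap_clause n m i j \<in> \<Gamma>" using \<Gamma>(3) ij unfolding swap_clauses_def by blast
  moreover have "swap_clause n m i j = Pos ` ?X \<union> ?D"
    using ij by (auto simp: swap_clause_def swap_vars_def)
  ultimately have C: "Pos ` ?X \<union> ?D \<in> \<Gamma>" by simp
  \<comment> \<open>The inserted negative literal is already in \<open>?D\<close>, so the weakening
    inside \<open>reaches_hyperresolvent\<close> is vacuous here; the same holds for column
    \<open>m\<close> below.\<close>
  have "reaches ?V (Suc (card ?X)) \<Gamma> {insert (Neg (m+1, j)) ?D}"
  proof (rule reaches_hyperresolvent[OF _ \<Gamma>(1) C])
    show "{Neg x, Neg (m+1, j)} \<in> \<Gamma>" if x: "x \<in> ?X" for x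
    proof -
      obtain l where "x = (l, j)" "l \<in> {1..n+1}" "l \<noteq> m+1" using x by blast
      with \<Gamma>(2) ij hole_in_PHP[of l n "m+1" j] show ?thesis by auto
    qed
  qed (use ij in auto)
  then have "reaches ?V (Suc (card ?X)) \<Gamma> {?D}" by simp
  then have "reaches ?V (Suc (card ?X) + Suc (card ?Y)) \<Gamma>
      ({?D} \<union> {insert (Neg (i, m)) {Neg (m+1, j), Neg (i, m)}})"
  proof (rule reaches_trans[OF _ \<Gamma>(1)])
    fix \<Delta> assume \<Delta>: "\<Gamma> \<union> {?D} \<subseteq> \<Delta>" "cnf_over ?V \<Delta>"
    have "?D = Pos ` ?Y \<union> {Neg (m+1, j), Neg (i, m)}" by auto
    with \<Delta>(1) have "Pos ` ?Y \<union> {Neg (m+1, j), Neg (i, m)} \<in> \<Delta>" by auto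
    then show "reaches ?V (Suc (card ?Y)) \<Delta> {insert (Neg (i, m)) {Neg (m+1, j), Neg (i, m)}}"
    proof (rule reaches_hyperresolvent[OF _ \<Delta>(2), rotated])
      show "{Neg x, Neg (i, m)} \<in> \<Delta>" if x: "x \<in> ?Y" for x
      proof -
        obtain l where "x = (l, m)" "l \<in> {1..n+1}" "l \<noteq> i" using x by blast
        with \<Gamma>(2) \<Delta>(1) ij hole_in_PHP[of l n i m] show ?thesis by auto
      qed
    qed (use ij in auto)
  qed
  moreover have "card ?X = n" "card ?Y = n"
    using ij by (auto simp: card_cartesian_product)
  ultimately show ?thesis by (auto elim!: reaches_mono simp: insert_commute)
qed

text \<open>Every hole open to pigeon \<open>m+1\<close> conflicts with \<open>(i, m)\<close>: the
  holes below \<open>m\<close> by \<open>reaches_pair\<close>, hole \<open>m\<close> by a hole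
  axiom. Hyperresolution on the restricted pigeon clause leaves only
  \<open>Neg (i, m)\<close>.\<close>

lemma reaches_unit:
  assumes \<Gamma>: "cnf_over ({1..n+1} \<times> {1..n}) \<Gamma>" "PHP n \<subseteq> \<Gamma>" "swap_clauses n m \<subseteq> \<Gamma>"
    and P: "Pos ` ({m+1} \<times> {1..m}) \<in> \<Gamma>"
    and i: "i \<in> {1..m}" "m \<le> n"
  shows "reaches ({1..n+1} \<times> {1..n}) (n * (2 * n + 2) + (n + 1)) \<Gamma> {{Neg (i, m)}}"
proof -
  let ?V = "{1..n+1} \<times> {1..n}"
  let ?S = "\<Union>j\<in>{1..<m}. {{Neg (i, m), Neg (m+1, j)}}"
  have "reaches ?V (card {1..<m} * (2 * n + 2)) \<Gamma> ?S"
    by (rule reaches_UN[OF _ \<Gamma>(1)]) (use reaches_pair \<Gamma> i in auto)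
  then have "reaches ?V (card {1..<m} * (2 * n + 2) + Suc (card ({m+1} \<times> {1..m}))) \<Gamma>
      (?S \<union> {insert (Neg (i, m)) {}})"
  proof (rule reaches_trans[OF _ \<Gamma>(1)])
    fix \<Delta> assume \<Delta>: "\<Gamma> \<union> ?S \<subseteq> \<Delta>" "cnf_over ?V \<Delta>"
    show "reaches ?V (Suc (card ({m+1} \<times> {1..m}))) \<Delta> {insert (Neg (i, m)) {}}"
    proof (rule reaches_hyperresolvent[OF _ \<Delta>(2)])
      show "{Neg x, Neg (i, m)} \<in> \<Delta>" if "x \<in> {m+1} \<times> {1..m}" for x
      proof (cases "snd x = m")
        case True
        then show ?thesis
          using that \<Gamma>(2) \<Delta>(1) i hole_in_PHP[of "m+1" n i m] by auto
      next
        case False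
        then show ?thesis using that \<Delta>(1) by (force simp: insert_commute)
      qed
    qed (use P \<Delta>(1) i in auto)
  qed
  then show ?thesis
  proof (rule reaches_mono)
    show "card {1..<m} * (2 * n + 2) + Suc (card ({m+1} \<times> {1..m})) \<le> n * (2 * n + 2) + (n + 1)"
      using i by (intro add_mono mult_le_mono1) (auto simp: card_cartesian_product)
  qed simp
qed

text \<open>This is one round of the descent. Pigeon \<open>m+2\<close> is used up to refute
  \<open>(i, Suc m)\<close> for each other pigeon \<open>i\<close>, which then loses hole
  \<open>Suc m\<close> by one resolution.\<close>

lemma reaches_shorter_pigeons:
  assumes \<Gamma>: "cnf_over ({1..n+1} \<times> {1..n}) \<Gamma>" "PHP n \<subseteq> \<Gamma>" "swap_clauses n (Suc m) \<subseteq> \<Gamma>"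
    and P: "\<And>i. i \<in> {1..m+2} \<Longrightarrow> Pos ` ({i} \<times> {1..m+1}) \<in> \<Gamma>"
    and m: "Suc m \<le> n"
  shows "reaches ({1..n+1} \<times> {1..n}) (n * (n * (2 * n + 2) + (n + 2))) \<Gamma>
    (\<Union>i\<in>{1..m+1}. {Pos ` ({i} \<times> {1..m})})"
proof -
  let ?V = "{1..n+1} \<times> {1..n}"
  have "reaches ?V (card {1..m+1} * (n * (2 * n + 2) + (n + 2))) \<Gamma>
      (\<Union>i\<in>{1..m+1}. {Pos ` ({i} \<times> {1..m})})"
  proof (rule reaches_UN[OF _ \<Gamma>(1)])
    fix i \<Delta> assume i: "i \<in> {1..m+1}" and \<Delta>: "\<Gamma> \<subseteq> \<Delta>" "cnf_over ?V \<Delta>"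
    have "reaches ?V (n * (2 * n + 2) + (n + 1)) \<Delta> {{Neg (i, Suc m)}}"
      by (rule reaches_unit) (use \<Gamma> \<Delta> i m P[of "m+2"] in auto)
    then have "reaches ?V (n * (2 * n + 2) + (n + 1) + 1) \<Delta>
      ({{Neg (i, Suc m)}} \<union> {Pos ` ({i} \<times> {1..m}) \<union> {}})"
    proof (rule reaches_trans[OF _ \<Delta>(2)])
      fix \<Theta> assume \<Theta>: "\<Delta> \<union> {{Neg (i, Suc m)}} \<subseteq> \<Theta>" "cnf_over ?V \<Theta>"
      have "Pos ` ({i} \<times> {1..m+1}) = insert (Pos (i, Suc m)) (Pos ` ({i} \<times> {1..m}))"
        by (auto simp: atLeastAtMostSuc_conv)
      moreover have "Pos ` ({i} \<times> {1..m+1}) \<in> \<Theta>" using P[of i] i \<Delta>(1) \<Theta>(1) by auto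
      ultimately show "reaches ?V 1 \<Theta> {Pos ` ({i} \<times> {1..m}) \<union> {}}"
        by (intro reaches_resolvent[OF \<Theta>(2), of "(i, Suc m)"])
           (use \<Theta>(1) in \<open>auto simp: is_clause_def tautological_def\<close>)
    qed
    then show "reaches ?V (n * (2 * n + 2) + (n + 2)) \<Delta> {Pos ` ({i} \<times> {1..m})}"
      by (rule reaches_mono) auto
  qed simp
  then show ?thesis by (rule reaches_mono[OF _ mult_le_mono1]) (use m in auto)
qed

lemma reaches_pigeons:
  assumes \<Gamma>: "cnf_over ({1..n+1} \<times> {1..n}) \<Gamma>" "PHP n \<subseteq> \<Gamma>" "\<And>m. m \<in> {1..n} \<Longrightarrow> swap_clauses n m \<subseteq> \<Gamma>"
    and "d \<le> n"
  shows "reaches ({1..n+1} \<times> {1..n}) (d * (n * (n * (2 * n + 2) + (n + 2)))) \<Gamma>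
    (\<Union>i\<in>{1..n-d+1}. {Pos ` ({i} \<times> {1..n-d})})"
  using \<open>d \<le> n\<close>
proof (induction d)
  case 0
  then show ?case using pigeon_in_PHP \<Gamma>(2) by (auto intro!: reaches_refl)
next
  case (Suc d)
  let ?V = "{1..n+1} \<times> {1..n}" and ?k = "n * (n * (2 * n + 2) + (n + 2))"
  define m where "m = n - Suc d"
  have m: "n - d = Suc m" "Suc m \<le> n" using Suc.prems by (auto simp: m_def)
  let ?S = "\<Union>i\<in>{1..m+2}. {Pos ` ({i} \<times> {1..m+1})}"
  have "reaches ?V (d * ?k) \<Gamma> ?S" using Suc m by simp
  then have "reaches ?V (d * ?k + ?k) \<Gamma> (?S \<union> (\<Union>i\<in>{1..m+1}. {Pos ` ({i} \<times> {1..m})}))"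
  proof (rule reaches_trans[OF _ \<Gamma>(1)])
    fix \<Delta> assume \<Delta>: "\<Gamma> \<union> ?S \<subseteq> \<Delta>" "cnf_over ?V \<Delta>"
    have "Pos ` ({i} \<times> {1..m+1}) \<in> \<Delta>" if "i \<in> {1..m+2}" for i
      using \<Delta>(1) that by blast
    moreover have "PHP n \<subseteq> \<Delta>" "swap_clauses n (Suc m) \<subseteq> \<Delta>"
      using \<Delta>(1) \<Gamma>(2) \<Gamma>(3)[of "Suc m"] m by auto
    ultimately show "reaches ?V ?k \<Delta> (\<Union>i\<in>{1..m+1}. {Pos ` ({i} \<times> {1..m})})"
      using m \<Delta>(2) by (intro reaches_shorter_pigeons)
  qed
  then show ?case by (rule reaches_mono) (auto simp: m_def)
qed

theorem lemma7p1:
  shows "\<exists>K c :: nat. \<forall>n\<ge>1. size_sbc_minus (PHP n) \<le> enat (K * n ^ c)"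
\<comment> \<open>The length is at most \<open>2 * n ^ 4 + 4 * n ^ 3 + 2 * n ^ 2 + 1\<close>, whose
  coefficients sum to 9.\<close>
proof (rule exI[of _ 10], rule exI[of _ 4], intro allI impI)
  fix n :: nat assume n: "n \<ge> 1"
  let ?V = "{1..n+1} \<times> {1..n}" and ?k = "n * (n * (2 * n + 2) + (n + 2))"
  let ?\<Gamma> = "PHP n \<union> (\<Union>m\<in>{0<..n}. swap_clauses n m)"
  have \<Gamma>: "derives ?V (n * (n * n)) (PHP n) ?\<Gamma>" using derives_swap_clauses[of n n] by simp
  \<comment> \<open>After \<open>n\<close> rounds pigeon 1 is left with no holes, and its clause is
    empty.\<close>
  have "reaches ?V (n * ?k) ?\<Gamma> (\<Union>i\<in>{1..n-n+1}. {Pos ` ({i} \<times> {1..n-n})})"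
    by (rule reaches_pigeons) (use derives_cnf_over[OF \<Gamma> cnf_over_PHP] in auto)
  then obtain \<Delta> where "derives ?V (n * ?k) ?\<Gamma> \<Delta>" "{} \<in> \<Delta>" by (auto simp: reaches_def)
  with derives_trans[OF \<Gamma>] have "size_sbc_minus (PHP n) \<le> enat (Suc (n * (n * n) + n * ?k))"
    using cnf_over_PHP[of n] by (intro size_sbc_minus_le) (auto simp: cnf_over_def cnf_vars_PHP)
  also have "Suc (n * (n * n) + n * ?k) \<le> 10 * n ^ 4"
  proof -
    have "n ^ 2 \<le> n ^ 4" "n ^ 3 \<le> n ^ 4" "1 \<le> n ^ 4" using n by (auto intro: power_increasing)
    moreover have "Suc (n * (n * n) + n * ?k) = 2 * n ^ 4 + 4 * n ^ 3 + 2 * n ^ 2 + 1"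
      by (simp add: eval_nat_numeral algebra_simps)
    ultimately show ?thesis by linarith
  qed
  finally show "size_sbc_minus (PHP n) \<le> enat (10 * n ^ 4)" by simp
qed

end
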